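(* Let $n,d$ be positive integers and $S=\mathbb{C}[x_0,\ldots,x_n]$. Let $I\subset S$ be the ideal of the $2^n$ points $[1:\pm1:\cdots:\pm1]\in\mathbb{P}^n$ and let $I^{(d)}$ be the ideal of the scheme of fat points of multiplicity $d$ supported on these points. Then $I^{(d)}=I^d$. Moreover, for any monomial ordering such that $x_n<x_i$ for all $i=0,\ldots,n-1$, the set of all monomials of degree $d$ in the $n$ quadrics $\mathcal{Q}_i=x_i^2-x_n^2$, $i=0,\ldots,n-1$, is a Gröbner basis for $I^{(d)}$.
   Context: For a point $P\in\mathbb{P}^n$ let $\wp_P\subset S$ be the homogeneous prime ideal generated by all forms vanishing at $P$. The ideal of the set of points $P_1,\ldots,P_g$ is $\wp_{P_1}\cap\cdots\cap\wp_{P_g}$, and the ideal of the scheme of fat points of multiplicity $d$ supported on them is $\wp_{P_1}^d\cap\cdots\cap\wp_{P_g}^d$. A Gröbner basis of an ideal is a set of generators whose initial terms generate the initial ideal. *)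

theory Defs
  imports Complex_Main "HOL-Library.Poly_Mapping" "HOL-Algebra.Ideal_Product"
begin

section \<open>The polynomial ring\<close>

text \<open>A monomial is its exponent vector, a finitely supported function from variable indices to
  \<^typ>\<open>nat\<close>; multiplication of monomials is addition of exponent vectors. A polynomial is a
  finitely supported function from monomials to coefficients, with the convolution product of
  \<^theory>\<open>HOL-Library.Poly_Mapping\<close>. The variable with index \<open>i\<close> stands for \<open>x\<^sub>i\<close>.\<close>

type_synonym monom = "nat \<Rightarrow>\<^sub>0 nat"
type_synonym mpoly = "monom \<Rightarrow>\<^sub>0 complex"

definition monomials :: "nat \<Rightarrow> monom set" where
  "monomials n = {m. Poly_Mapping.keys m \<subseteq> {..n}}"

definition var_monom :: "nat \<Rightarrow> monom" where
  "var_monom i = Poly_Mapping.single i 1"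

definition var :: "nat \<Rightarrow> mpoly" where
  "var i = Poly_Mapping.single (var_monom i) 1"

text \<open>The ring \<open>\<complex>[x\<^sub>0, \<dots>, x\<^sub>n]\<close>, on \<open>n + 1\<close> variables.\<close>

definition poly_ring :: "nat \<Rightarrow> mpoly ring" where
  "poly_ring n =
     \<lparr> carrier = {f. Poly_Mapping.keys f \<subseteq> monomials n},
       mult = (*), one = 1, zero = 0, add = (+) \<rparr>"

lemma poly_ring_cring: "cring (poly_ring n)"
proof -
  have add: "a + b \<in> monomials n" if "a \<in> monomials n" "b \<in> monomials n" for a b
    using that keys_add[of a b] by (auto simp: monomials_def)
  have zero: "0 \<in> monomials n"
    by (simp add: monomials_def)
  have padd: "Poly_Mapping.keys (f + g) \<subseteq> monomials n"
    if "Poly_Mapping.keys f \<subseteq> monomials n" "Poly_Mapping.keys g \<subseteq> monomials n" for f g :: mpoly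
    using that keys_add[of f g] by auto
  have pmult: "Poly_Mapping.keys (f * g) \<subseteq> monomials n"
    if "Poly_Mapping.keys f \<subseteq> monomials n" "Poly_Mapping.keys g \<subseteq> monomials n" for f g :: mpoly
    using that keys_mult[of f g] add by fastforce
  have "abelian_group (poly_ring n)"
  proof (rule abelian_groupI)
    fix f assume "f \<in> carrier (poly_ring n)"
    then show "\<exists>g\<in>carrier (poly_ring n). g \<oplus>\<^bsub>poly_ring n\<^esub> f = \<zero>\<^bsub>poly_ring n\<^esub>"
      by (intro bexI[of _ "- f"]) (auto simp: poly_ring_def)
  qed (auto simp: poly_ring_def padd[THEN subsetD] add.assoc add.commute)
  moreover have "comm_monoid (poly_ring n)"
    by (rule comm_monoidI)
      (auto simp: poly_ring_def pmult[THEN subsetD] mult.assoc mult.commute zero)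
  ultimately show ?thesis
    by (rule cringI) (simp add: poly_ring_def distrib_right)
qed

definition total_degree :: "monom \<Rightarrow> nat" where
  "total_degree m = (\<Sum>i\<in>Poly_Mapping.keys m. Poly_Mapping.lookup m i)"

text \<open>A form is a homogeneous polynomial of some degree; the zero polynomial counts as a form.\<close>

definition is_form :: "mpoly \<Rightarrow> bool" where
  "is_form f \<longleftrightarrow> (\<exists>k. \<forall>m\<in>Poly_Mapping.keys f. total_degree m = k)"

definition eval_monom :: "(nat \<Rightarrow> complex) \<Rightarrow> monom \<Rightarrow> complex" where
  "eval_monom v m = (\<Prod>i\<in>Poly_Mapping.keys m. v i ^ Poly_Mapping.lookup m i)"

definition eval_poly :: "(nat \<Rightarrow> complex) \<Rightarrow> mpoly \<Rightarrow> complex" where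
  "eval_poly v f = (\<Sum>m\<in>Poly_Mapping.keys f. Poly_Mapping.lookup f m * eval_monom v m)"


section \<open>Points of projective space and their ideals\<close>

text \<open>The point \<open>[v 0 : \<dots> : v n]\<close> of \<open>\<PP>\<^sup>n\<close> (for \<open>v\<close> not vanishing identically on \<open>{..n}\<close>) is
  the set of all its homogeneous coordinate vectors; these vectors are made
  \<^const>\<open>undefined\<close> outside \<open>{..n}\<close> so that only the coordinates \<open>0, \<dots>, n\<close> matter.\<close>

definition proj_point :: "nat \<Rightarrow> (nat \<Rightarrow> complex) \<Rightarrow> (nat \<Rightarrow> complex) set" where
  "proj_point n v = {restrict (\<lambda>i. c * v i) {..n} | c. c \<noteq> 0}"

definition vanishes_at :: "mpoly \<Rightarrow> (nat \<Rightarrow> complex) set \<Rightarrow> bool" where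
  "vanishes_at f P \<longleftrightarrow> (\<forall>w\<in>P. eval_poly w f = 0)"

definition point_ideal :: "nat \<Rightarrow> (nat \<Rightarrow> complex) set \<Rightarrow> mpoly set" where
  "point_ideal n P = Idl\<^bsub>poly_ring n\<^esub> {f \<in> carrier (poly_ring n). is_form f \<and> vanishes_at f P}"

definition points_ideal :: "nat \<Rightarrow> (nat \<Rightarrow> complex) set set \<Rightarrow> mpoly set" where
  "points_ideal n X = (\<Inter>P\<in>X. point_ideal n P)"

text \<open>Powers of ideals are powers in the multiplicative monoid \<^const>\<open>ideals_set\<close> of all ideals.\<close>

definition ideal_power :: "nat \<Rightarrow> mpoly set \<Rightarrow> nat \<Rightarrow> mpoly set" where
  "ideal_power n I d = I [^]\<^bsub>ideals_set (poly_ring n)\<^esub> d"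

definition fat_points_ideal :: "nat \<Rightarrow> (nat \<Rightarrow> complex) set set \<Rightarrow> nat \<Rightarrow> mpoly set" where
  "fat_points_ideal n X d = (\<Inter>P\<in>X. ideal_power n (point_ideal n P) d)"

text \<open>The points \<open>[1 : \<plusminus>1 : \<dots> : \<plusminus>1]\<close>.\<close>

definition sign_points :: "nat \<Rightarrow> (nat \<Rightarrow> complex) set set" where
  "sign_points n = {proj_point n v | v. v 0 = 1 \<and> (\<forall>i\<in>{1..n}. v i = 1 \<or> v i = - 1)}"

lemma card_sign_points: "card (sign_points n) = 2 ^ n"
proof -
  define E where "E = {1..n} \<rightarrow>\<^sub>E {1, - 1 :: complex}"
  define pt where "pt e = proj_point n (e(0 := 1))" for e :: "nat \<Rightarrow> complex"
  have "sign_points n = pt ` E"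
  proof (intro equalityI subsetI)
    fix P assume "P \<in> sign_points n"
    then obtain v where v: "P = proj_point n v" "v 0 = 1" "\<forall>i\<in>{1..n}. v i = 1 \<or> v i = - 1"
      unfolding sign_points_def by blast
    have "restrict v {1..n} \<in> E"
      using v(3) by (auto simp: E_def)
    moreover have "restrict (\<lambda>i. c * v i) {..n}
        = restrict (\<lambda>i. c * ((restrict v {1..n})(0 := 1)) i) {..n}" for c
      using v(2) by (auto simp: restrict_def fun_eq_iff)
    then have "P = pt (restrict v {1..n})"
      unfolding pt_def proj_point_def v(1) by simp
    ultimately show "P \<in> pt ` E"
      by blast
  next
    fix P assume "P \<in> pt ` E"
    then obtain e where e: "e \<in> E" "P = pt e" by blast
    have "\<forall>i\<in>{1..n}. (e(0 := 1)) i = 1 \<or> (e(0 := 1)) i = - 1"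
      using e(1) by (auto simp: E_def PiE_iff)
    then show "P \<in> sign_points n"
      unfolding sign_points_def e(2) pt_def
      by (intro CollectI exI[of _ "e(0 := 1)"]) simp
  qed
  moreover have "inj_on pt E"
  proof (rule inj_onI)
    fix e e' assume e: "e \<in> E" "e' \<in> E" and "pt e = pt e'"
    moreover have "restrict (\<lambda>i. 1 * (e(0 := 1)) i) {..n} \<in> pt e"
      unfolding pt_def proj_point_def by (intro CollectI exI[of _ 1]) simp
    ultimately obtain c where
      "restrict (\<lambda>i. 1 * (e(0 := 1)) i) {..n} = restrict (\<lambda>i. c * (e'(0 := 1)) i) {..n}"
      unfolding pt_def proj_point_def by auto
    then have eq: "(e(0 := 1)) i = c * (e'(0 := 1)) i" if "i \<le> n" for i
      using that by (auto simp: restrict_def fun_eq_iff split: if_splits)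
    have "c = 1"
      using eq[of 0] by simp
    then have "e i = e' i" if "i \<in> {1..n}" for i
      using eq[of i] that by auto
    then show "e = e'"
      using e unfolding E_def by (meson PiE_ext)
  qed
  ultimately have "card (sign_points n) = card E"
    by (simp add: card_image)
  then show ?thesis
    by (simp add: E_def card_PiE numeral_2_eq_2)
qed


section \<open>Monomial orderings and Groebner bases\<close>

text \<open>\<open>(a, b) \<in> r\<close> means that \<open>a \<le> b\<close> in the ordering. As usual, a monomial ordering is a total
  well-ordering compatible with multiplication.\<close>

definition monomial_ordering :: "nat \<Rightarrow> monom rel \<Rightarrow> bool" where
  "monomial_ordering n r \<longleftrightarrow>
     well_order_on (monomials n) r \<and>
     (\<forall>a\<in>monomials n. \<forall>b\<in>monomials n. \<forall>c\<in>monomials n. (a, b) \<in> r \<longrightarrow> (a + c, b + c) \<in> r)"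

definition initial_monom :: "monom rel \<Rightarrow> mpoly \<Rightarrow> monom" where
  "initial_monom r f =
     (THE m. m \<in> Poly_Mapping.keys f \<and> (\<forall>m'\<in>Poly_Mapping.keys f. (m', m) \<in> r))"

text \<open>The initial term of the zero polynomial is zero.\<close>

definition initial_term :: "monom rel \<Rightarrow> mpoly \<Rightarrow> mpoly" where
  "initial_term r f =
     (if f = 0 then 0
      else Poly_Mapping.single (initial_monom r f) (Poly_Mapping.lookup f (initial_monom r f)))"

definition initial_ideal :: "nat \<Rightarrow> monom rel \<Rightarrow> mpoly set \<Rightarrow> mpoly set" where
  "initial_ideal n r I = Idl\<^bsub>poly_ring n\<^esub> (initial_term r ` I)"

definition is_groebner_basis :: "nat \<Rightarrow> monom rel \<Rightarrow> mpoly set \<Rightarrow> mpoly set \<Rightarrow> bool" where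
  "is_groebner_basis n r I G \<longleftrightarrow>
     G \<subseteq> carrier (poly_ring n) \<and>
     Idl\<^bsub>poly_ring n\<^esub> G = I \<and>
     Idl\<^bsub>poly_ring n\<^esub> (initial_term r ` G) = initial_ideal n r I"


section \<open>The quadrics\<close>

definition quadric :: "nat \<Rightarrow> nat \<Rightarrow> mpoly" where
  "quadric n i = var i ^ 2 - var n ^ 2"

definition quadric_monomials :: "nat \<Rightarrow> nat \<Rightarrow> mpoly set" where
  "quadric_monomials n d =
     {(\<Prod>i<n. quadric n i ^ a i) | a :: nat \<Rightarrow> nat. (\<Sum>i<n. a i) = d}"

end

theory Submission
  imports Defs "HOL-Computational_Algebra.Polynomial"
begin

text \<open>Write \<open>Q\<^sub>i = x\<^sub>i\<^sup>2 - x\<^sub>n\<^sup>2\<close> and let \<open>F\<close> be the ideal of the fat points and \<open>I\<close> the ideal of the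
  points. The products of \<open>d\<close> quadrics lie in \<open>I\<^sup>d\<close>, and \<open>I\<^sup>d \<subseteq> F\<close> holds trivially, so both claims
  concern the elements of \<open>F\<close>: each must be generated by the products of \<open>d\<close> quadrics, and its
  initial monomial must be divisible by some \<open>x\<^sup>2\<^sup>a\<close> with \<open>a\<close> supported on \<open>{0, \<dots>, n - 1}\<close> and
  \<open>|a| = d\<close>.

  The polynomials \<open>B\<^sub>m = x\<^sup>e Q\<^sup>a x\<^sub>n\<^sup>k\<close> with \<open>m = (2 a + e, k)\<close> and \<open>e \<in> {0, 1}\<^sup>n\<close> span the polynomial
  ring (\<open>quadric_comb_surj\<close>). For an ordering in which \<open>x\<^sub>n\<close> is the least variable, \<open>B\<^sub>m\<close> is monic with
  leading monomial \<open>x\<^sup>m\<close>, so the initial monomial of a combination of the \<open>B\<^sub>m\<close> is the largest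
  index that occurs in it (\<open>initial_monom_quadric_comb\<close>). Both claims follow once every \<open>B\<^sub>m\<close> that
  occurs in an element of \<open>F\<close> is known to satisfy \<open>|a| \<ge> d\<close>.

  This is \<open>quadric_degree_ge\<close>. An element of \<open>F\<close> vanishes to order \<open>d\<close> at \<open>t = 0\<close> on every line
  \<open>c (s, 1) + t (w, 0)\<close> with \<open>s \<in> {1, -1}\<^sup>n\<close>. On such a line \<open>Q\<^sub>i\<close> becomes
  \<open>2 c s\<^sub>i w\<^sub>i t + w\<^sub>i\<^sup>2 t\<^sup>2\<close>, so \<open>B\<^sub>m\<close> is divisible by exactly the power \<open>t ^ |a|\<close> for generic \<open>w\<close>. If the
  smallest \<open>|a|\<close> that occurs were below \<open>d\<close>, the coefficient of \<open>t ^ |a|\<close> would give a linear relation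
  between the functions \<open>(c, s, u) \<mapsto> (c s)\<^sup>e u\<^sup>a c\<^sup>k\<close>, where \<open>u\<^sub>i = 2 c s\<^sub>i w\<^sub>i\<close>. These are pairwise distinct
  multiplicative characters, hence linearly independent (\<open>characters_independent\<close>).\<close>

section \<open>The polynomial ring and its ideals\<close>

lemma poly_mapping_induct_add [consumes 1, case_names zero single add]:
  fixes f :: "'a \<Rightarrow>\<^sub>0 'b::comm_monoid_add"
  assumes "Poly_Mapping.keys f \<subseteq> A"
    and "P 0"
    and "\<And>m c. m \<in> A \<Longrightarrow> P (Poly_Mapping.single m c)"
    and "\<And>f g. P f \<Longrightarrow> P g \<Longrightarrow> P (f + g)"
  shows "P f"
proof -
  have "P (\<Sum>m\<in>K. Poly_Mapping.single m (Poly_Mapping.lookup f m))" if "finite K" "K \<subseteq> A" for K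
    using that by (induction K rule: finite_induct) (auto intro: assms)
  moreover have "f = (\<Sum>m\<in>Poly_Mapping.keys f. Poly_Mapping.single m (Poly_Mapping.lookup f m))"
    by (rule poly_mapping_eqI)
      (auto simp: lookup_sum lookup_single when_def sum.delta' in_keys_iff)
  ultimately show ?thesis
    using assms(1) finite_keys by metis
qed

lemma poly_ring_simps [simp]:
  "f \<in> carrier (poly_ring n) \<longleftrightarrow> Poly_Mapping.keys f \<subseteq> monomials n"
  "monoid.mult (poly_ring n) = (*)" "one (poly_ring n) = 1"
  "zero (poly_ring n) = 0" "add (poly_ring n) = (+)"
  by (simp_all add: poly_ring_def)

lemma monomials_add: "a \<in> monomials n \<Longrightarrow> b \<in> monomials n \<Longrightarrow> a + b \<in> monomials n"
  using keys_add[of a b] by (auto simp: monomials_def)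

lemma zero_in_monomials: "0 \<in> monomials n"
  by (simp add: monomials_def)

lemma var_monom_in_monomials: "i \<le> n \<Longrightarrow> var_monom i \<in> monomials n"
  by (simp add: monomials_def var_monom_def)

lemma poly_ring_add_closed:
  fixes f g :: mpoly
  assumes "Poly_Mapping.keys f \<subseteq> monomials n" "Poly_Mapping.keys g \<subseteq> monomials n"
  shows "Poly_Mapping.keys (f + g) \<subseteq> monomials n"
  using assms keys_add[of f g] by auto

lemma poly_ring_mult_closed:
  fixes f g :: mpoly
  assumes "Poly_Mapping.keys f \<subseteq> monomials n" "Poly_Mapping.keys g \<subseteq> monomials n"
  shows "Poly_Mapping.keys (f * g) \<subseteq> monomials n"
  using assms keys_mult[of f g] monomials_add[of _ n] by fastforce

lemma poly_ring_power_closed: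
  fixes f :: mpoly
  assumes "Poly_Mapping.keys f \<subseteq> monomials n"
  shows "Poly_Mapping.keys (f ^ k) \<subseteq> monomials n"
  by (induction k) (simp_all add: poly_ring_mult_closed assms zero_in_monomials)

lemma poly_ring_prod_closed:
  fixes f :: "'a \<Rightarrow> mpoly"
  assumes "\<And>i. i \<in> A \<Longrightarrow> Poly_Mapping.keys (f i) \<subseteq> monomials n"
  shows "Poly_Mapping.keys (\<Prod>i\<in>A. f i) \<subseteq> monomials n"
  using assms
  by (induction A rule: infinite_finite_induct) (simp_all add: poly_ring_mult_closed zero_in_monomials)

lemma poly_ring_const_closed: "Poly_Mapping.keys (Poly_Mapping.single 0 c) \<subseteq> monomials n"
  by (simp add: zero_in_monomials)

lemma poly_ring_var_closed: "i \<le> n \<Longrightarrow> Poly_Mapping.keys (var i) \<subseteq> monomials n"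
  by (simp add: var_def var_monom_in_monomials)

lemma poly_ring_quadric_closed: "i \<le> n \<Longrightarrow> Poly_Mapping.keys (quadric n i) \<subseteq> monomials n"
  using keys_diff[of "var i ^ 2" "var n ^ 2"] poly_ring_power_closed[OF poly_ring_var_closed]
  unfolding quadric_def by blast

lemma lookup_const_mult:
  "Poly_Mapping.lookup (Poly_Mapping.single 0 c * f) m = c * Poly_Mapping.lookup (f :: mpoly) m"
  by (simp flip: mult_map_scale_conv_mult add: map.rep_eq when_def)

lemma poly_ring_induct [consumes 1, case_names const var add]:
  assumes "f \<in> carrier (poly_ring n)"
    and const: "\<And>c. P (Poly_Mapping.single 0 c)"
    and var: "\<And>i g. i \<le> n \<Longrightarrow> P g \<Longrightarrow> P (var i * g)"
    and add: "\<And>f g. P f \<Longrightarrow> P g \<Longrightarrow> P (f + g)"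
  shows "P f"
proof -
  have single: "P (Poly_Mapping.single m c)" if "m \<in> monomials n" for m c
    using that
  proof (induction "\<Sum>j\<le>n. Poly_Mapping.lookup m j" arbitrary: m rule: less_induct)
    case less
    show ?case
    proof (cases "m = 0")
      case True
      then show ?thesis using const by simp
    next
      case False
      then obtain i where i: "i \<in> Poly_Mapping.keys m" by fastforce
      define m' where "m' = m - var_monom i"
      have lk: "Poly_Mapping.lookup m' j = Poly_Mapping.lookup m j - (if i = j then 1 else 0)" for j
        by (simp add: m'_def var_monom_def lookup_minus lookup_single when_def)
      have pos: "Poly_Mapping.lookup m i > 0"
        using i by (simp add: in_keys_iff)
      have m: "m = var_monom i + m'"
        by (rule poly_mapping_eqI)
          (use pos in \<open>auto simp: lookup_add lk var_monom_def lookup_single when_def\<close>)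
      have "m' \<in> monomials n"
        using less.prems lk by (auto simp: monomials_def in_keys_iff subset_iff)
      moreover have "i \<le> n"
        using i less.prems by (auto simp: monomials_def)
      moreover have "(\<Sum>j\<le>n. Poly_Mapping.lookup m' j) < (\<Sum>j\<le>n. Poly_Mapping.lookup m j)"
        by (rule sum_strict_mono_ex1) (use lk pos \<open>i \<le> n\<close> in auto)
      ultimately have "P (var i * Poly_Mapping.single m' c)"
        using less.hyps var by blast
      then show ?thesis
        by (simp add: var_def mult_single m)
    qed
  qed
  have "Poly_Mapping.keys f \<subseteq> monomials n"
    using assms(1) by simp
  then show ?thesis
    by (induction rule: poly_mapping_induct_add) (use single add const[of 0] in auto)
qed

text \<open>Over a commutative ring with one, closure under negation follows from closure under
  multiplication by \<open>- 1\<close>.\<close>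

lemma ideal_poly_ring_iff:
  "ideal I (poly_ring n) \<longleftrightarrow>
     I \<subseteq> carrier (poly_ring n) \<and> 0 \<in> I \<and> (\<forall>a\<in>I. \<forall>b\<in>I. a + b \<in> I) \<and>
     (\<forall>f\<in>carrier (poly_ring n). \<forall>a\<in>I. f * a \<in> I)"
  (is "_ \<longleftrightarrow> ?R")
proof
  assume "ideal I (poly_ring n)"
  then interpret ideal I "poly_ring n" .
  show ?R
    using a_subset additive_subgroup.zero_closed[OF additive_subgroup_axioms]
      additive_subgroup.a_closed[OF additive_subgroup_axioms] I_l_closed by auto
next
  interpret cring "poly_ring n" by (rule poly_ring_cring)
  assume I: ?R
  show "ideal I (poly_ring n)"
  proof (rule idealI)
    show "ring (poly_ring n)" by (rule ring_axioms)
    show "subgroup I (add_monoid (poly_ring n))"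
    proof (rule add.subgroupI)
      show "I \<subseteq> carrier (poly_ring n)" "I \<noteq> {}" using I by auto
      fix a assume a: "a \<in> I"
      show "\<ominus>\<^bsub>poly_ring n\<^esub> a \<in> I"
      proof -
        have "a \<in> carrier (poly_ring n)" using I a by blast
        then have "\<ominus>\<^bsub>poly_ring n\<^esub> a = - 1 * a"
          by (intro minus_equality) auto
        moreover have "- 1 \<in> carrier (poly_ring n)"
          by (simp add: zero_in_monomials)
        ultimately show ?thesis using I a by metis
      qed
      fix b assume "b \<in> I"
      then show "a \<oplus>\<^bsub>poly_ring n\<^esub> b \<in> I" using I a by simp
    qed
    fix a x assume "a \<in> I" "x \<in> carrier (poly_ring n)"
    then show "x \<otimes>\<^bsub>poly_ring n\<^esub> a \<in> I" "a \<otimes>\<^bsub>poly_ring n\<^esub> x \<in> I"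
      using I by (simp_all add: mult.commute[of a x])
  qed
qed

lemma ideal_mult_closed:
  assumes "ideal I (poly_ring n)" and "Poly_Mapping.keys f \<subseteq> monomials n" and "a \<in> I"
  shows "f * a \<in> I"
  using ideal.I_l_closed[OF assms(1,3), of f] assms(2) by simp

lemma ideal_sum_closed:
  assumes "ideal I (poly_ring n)" and "\<And>m. m \<in> A \<Longrightarrow> g m \<in> I"
  shows "(\<Sum>m\<in>A. g m) \<in> I"
proof -
  have "0 \<in> I" "\<And>a b. a \<in> I \<Longrightarrow> b \<in> I \<Longrightarrow> a + b \<in> I"
    using assms(1) unfolding ideal_poly_ring_iff by auto
  then show ?thesis
    using assms(2) by (induction A rule: infinite_finite_induct) simp_all
qed

lemma ideal_point_ideal: "ideal (point_ideal n P) (poly_ring n)"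
  unfolding point_ideal_def
  by (rule ring.genideal_ideal[OF cring.axioms(1)[OF poly_ring_cring]]) auto

lemma ideal_points_ideal:
  assumes "X \<noteq> {}"
  shows "ideal (points_ideal n X) (poly_ring n)"
proof -
  interpret cring "poly_ring n" by (rule poly_ring_cring)
  show ?thesis
    unfolding points_ideal_def using assms ideal_point_ideal
    by (intro i_Intersect) auto
qed

lemma ideal_power_0: "ideal_power n I 0 = carrier (poly_ring n)"
  by (simp add: ideal_power_def nat_pow_def ideals_set_def)

lemma ideal_power_Suc:
  "ideal_power n I (Suc d) = ideal_prod (poly_ring n) (ideal_power n I d) I"
  by (simp add: ideal_power_def nat_pow_def ideals_set_def)

lemma ideal_ideal_power:
  assumes "ideal I (poly_ring n)"
  shows "ideal (ideal_power n I d) (poly_ring n)"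
proof -
  interpret cring "poly_ring n" by (rule poly_ring_cring)
  show ?thesis
    by (induction d)
      (simp_all add: ideal_power_0 ideal_power_Suc oneideal ideal_prod_is_ideal assms)
qed

lemma ideal_power_mono:
  assumes "I \<subseteq> J"
  shows "ideal_power n I d \<subseteq> ideal_power n J d"
proof (induction d)
  case (Suc d)
  show ?case
  proof
    fix f assume "f \<in> ideal_power n I (Suc d)"
    then show "f \<in> ideal_power n J (Suc d)"
      unfolding ideal_power_Suc
    proof (induction rule: ideal_prod.induct)
      case (prod i j)
      then show ?case using Suc assms by (blast intro: ideal_prod.prod)
    next
      case (sum s1 s2)
      then show ?case by (blast intro: ideal_prod.sum)
    qed
  qed
qed (simp add: ideal_power_0)

lemma prod_powers_in_ideal_power:
  assumes "ideal I (poly_ring n)" and "\<And>i. i \<in> A \<Longrightarrow> q i \<in> I" and "finite A"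
  shows "(\<Prod>i\<in>A. q i ^ a i) \<in> ideal_power n I (\<Sum>i\<in>A. a i)"
proof -
  have step: "f * q i ^ k \<in> ideal_power n I (e + k)" if "f \<in> ideal_power n I e" "i \<in> A" for f e i k
  proof (induction k)
    case (Suc k)
    then have "f * q i ^ k * q i \<in> ideal_power n I (Suc (e + k))"
      unfolding ideal_power_Suc using ideal_prod.prod[of _ _ _ I "poly_ring n"] assms(2) \<open>i \<in> A\<close>
      by fastforce
    then show ?case by (simp add: mult_ac)
  qed (use that in simp)
  have "(\<Prod>i\<in>B. q i ^ a i) \<in> ideal_power n I (\<Sum>i\<in>B. a i)" if "finite B" "B \<subseteq> A" for B
    using that
  proof (induction B rule: finite_induct)
    case empty
    then show ?case by (simp add: ideal_power_0 zero_in_monomials)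
  next
    case (insert i B)
    then show ?case
      using step[of "\<Prod>i\<in>B. q i ^ a i" "\<Sum>i\<in>B. a i" i "a i"] by (simp add: mult.commute add.commute)
  qed
  then show ?thesis using assms(3) by blast
qed


section \<open>Substitution of univariate polynomials\<close>

text \<open>The homomorphism \<open>\<complex>[x\<^sub>0, x\<^sub>1, \<dots>] \<rightarrow> \<complex>[t]\<close> with \<open>x\<^sub>i \<mapsto> p i\<close>. The variable \<open>t\<close>
  is written \<open>[:0, 1:]\<close> below.\<close>

definition subst :: "(nat \<Rightarrow> complex poly) \<Rightarrow> mpoly \<Rightarrow> complex poly" where
  "subst p f = (\<Sum>m\<in>Poly_Mapping.keys f. [:Poly_Mapping.lookup f m:] *
     (\<Prod>i\<in>Poly_Mapping.keys m. p i ^ Poly_Mapping.lookup m i))"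

lemma subst_zero [simp]: "subst p 0 = 0"
  by (simp add: subst_def)

lemma subst_single:
  "subst p (Poly_Mapping.single m c) =
     [:c:] * (\<Prod>i\<in>Poly_Mapping.keys m. p i ^ Poly_Mapping.lookup m i)"
  by (simp add: subst_def)

lemma subst_add: "subst p (f + g) = subst p f + subst p g"
  unfolding subst_def
  by (rule setsum_keys_plus_distrib) (simp_all add: smult_add_left)

lemma subst_mult: "subst p (f * g) = subst p f * subst p g"
proof -
  have monom: "(\<Prod>i\<in>Poly_Mapping.keys (k + l). p i ^ Poly_Mapping.lookup (k + l) i) =
      (\<Prod>i\<in>Poly_Mapping.keys k. p i ^ Poly_Mapping.lookup k i) *
      (\<Prod>i\<in>Poly_Mapping.keys l. p i ^ Poly_Mapping.lookup l i)" for k l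
  proof -
    let ?K = "Poly_Mapping.keys k \<union> Poly_Mapping.keys l"
    have prod_K: "(\<Prod>i\<in>Poly_Mapping.keys m. p i ^ Poly_Mapping.lookup m i) =
        (\<Prod>i\<in>?K. p i ^ Poly_Mapping.lookup m i)" if "Poly_Mapping.keys m \<subseteq> ?K" for m
      by (rule prod.mono_neutral_left) (use that in \<open>auto simp: in_keys_iff\<close>)
    show ?thesis
      unfolding prod_K[OF keys_add] prod_K[OF Un_upper1] prod_K[OF Un_upper2]
      by (simp add: lookup_add power_add prod.distrib)
  qed
  have single: "subst p (Poly_Mapping.single k c * g) = subst p (Poly_Mapping.single k c) * subst p g"
    for k c
    using subset_UNIV[of "Poly_Mapping.keys g"]
  proof (induction g rule: poly_mapping_induct_add)
    case (single m c')
    then show ?case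
      by (simp add: mult_single subst_single monom mult_ac)
  qed (simp_all add: distrib_left subst_add)
  show ?thesis
    using subset_UNIV[of "Poly_Mapping.keys f"]
    by (induction f rule: poly_mapping_induct_add)
      (simp_all add: single distrib_right subst_add)
qed

lemma subst_const [simp]: "subst p (Poly_Mapping.single 0 c) = [:c:]"
  by (simp add: subst_single)

lemma subst_one [simp]: "subst p 1 = 1"
  using subst_const[of p 1] by simp

lemma subst_var [simp]: "subst p (var i) = p i"
  by (simp add: var_def var_monom_def subst_single)

lemma subst_power: "subst p (f ^ k) = subst p f ^ k"
  by (induction k) (simp_all add: subst_mult)

lemma subst_sum: "subst p (\<Sum>i\<in>A. f i) = (\<Sum>i\<in>A. subst p (f i))"
  by (induction A rule: infinite_finite_induct) (simp_all add: subst_add)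

lemma subst_prod: "subst p (\<Prod>i\<in>A. f i) = (\<Prod>i\<in>A. subst p (f i))"
  by (induction A rule: infinite_finite_induct) (simp_all add: subst_mult)

lemma subst_quadric: "subst p (quadric n i) = p i ^ 2 - p n ^ 2"
  using subst_add[of p "quadric n i" "var n ^ 2"] by (simp add: quadric_def subst_power)

lemma poly_subst: "poly (subst p f) x = eval_poly (\<lambda>i. poly (p i) x) f"
  by (simp add: subst_def eval_poly_def eval_monom_def poly_sum poly_prod poly_power)

lemma eval_poly_cong:
  assumes "Poly_Mapping.keys f \<subseteq> monomials n" and "\<And>i. i \<le> n \<Longrightarrow> v i = w i"
  shows "eval_poly v f = eval_poly w f"
  unfolding eval_poly_def eval_monom_def
  using assms by (fastforce intro!: sum.cong prod.cong arg_cong2[of _ _ _ _ "(*)"]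
      simp: monomials_def)


section \<open>A basis adapted to the quadrics\<close>

text \<open>The polynomial \<open>x\<^sup>e Q\<^sup>a x\<^sub>n\<^sup>k\<close> with \<open>m\<^sub>i = 2 a\<^sub>i + e\<^sub>i\<close> and \<open>e\<^sub>i \<le> 1\<close> for \<open>i < n\<close>, and \<open>k = m\<^sub>n\<close>.\<close>

definition quadric_basis :: "nat \<Rightarrow> monom \<Rightarrow> mpoly" where
  "quadric_basis n m =
     (\<Prod>i<n. var i ^ (Poly_Mapping.lookup m i mod 2) * quadric n i ^ (Poly_Mapping.lookup m i div 2)) *
     var n ^ Poly_Mapping.lookup m n"

text \<open>The number of quadrics, with multiplicity, in \<^term>\<open>quadric_basis n m\<close>.\<close>

definition quadric_degree :: "nat \<Rightarrow> monom \<Rightarrow> nat" where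
  "quadric_degree n m = (\<Sum>i<n. Poly_Mapping.lookup m i div 2)"

text \<open>The combination of the basis elements whose coefficient family is \<open>g\<close>; the type of
  polynomials serves here as the type of finitely supported coefficient families.\<close>

definition quadric_comb :: "nat \<Rightarrow> mpoly \<Rightarrow> mpoly" where
  "quadric_comb n g =
     (\<Sum>m\<in>Poly_Mapping.keys g. Poly_Mapping.single 0 (Poly_Mapping.lookup g m) * quadric_basis n m)"

lemma quadric_comb_add: "quadric_comb n (f + g) = quadric_comb n f + quadric_comb n g"
  unfolding quadric_comb_def
  by (rule setsum_keys_plus_distrib) (simp_all add: single_add distrib_right)

lemma quadric_comb_single:
  "quadric_comb n (Poly_Mapping.single m c) = Poly_Mapping.single 0 c * quadric_basis n m"
  by (simp add: quadric_comb_def)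

lemma quadric_basis_zero [simp]: "quadric_basis n 0 = 1"
  by (simp add: quadric_basis_def)

lemma lookup_var_monom: "Poly_Mapping.lookup (var_monom i) j = (if i = j then 1 else 0)"
  by (simp add: var_monom_def lookup_single when_def)

lemma var_last_mult_quadric_basis:
  "var n * quadric_basis n m = quadric_basis n (var_monom n + m)"
proof -
  have "Poly_Mapping.lookup (var_monom n + m) i = Poly_Mapping.lookup m i" if "i < n" for i
    using that by (simp add: lookup_add lookup_var_monom)
  then show ?thesis
    by (simp add: quadric_basis_def lookup_add lookup_var_monom mult_ac)
qed

text \<open>Multiplication by \<open>x\<^sub>i\<close> with \<open>i < n\<close>: if the exponent of \<open>x\<^sub>i\<close> is odd, the square of \<open>x\<^sub>i\<close> that
  arises is rewritten as \<open>Q\<^sub>i + x\<^sub>n\<^sup>2\<close>.\<close>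

lemma var_mult_quadric_basis:
  assumes "i < n"
  shows "var i * quadric_basis n m =
    (if even (Poly_Mapping.lookup m i) then quadric_basis n (var_monom i + m)
     else quadric_basis n (var_monom i + m) +
       quadric_basis n (m - var_monom i + (var_monom n + var_monom n)))"
proof -
  define E :: "nat \<Rightarrow> nat \<Rightarrow> mpoly"
    where "E j k = var j ^ (k mod 2) * quadric n j ^ (k div 2)" for j k
  have basis: "quadric_basis n m' =
      E i (Poly_Mapping.lookup m' i) *
      (\<Prod>j\<in>{..<n} - {i}. E j (Poly_Mapping.lookup m j)) * var n ^ Poly_Mapping.lookup m' n"
    if "\<And>j. j \<noteq> i \<Longrightarrow> j < n \<Longrightarrow> Poly_Mapping.lookup m' j = Poly_Mapping.lookup m j" for m'
  proof -
    have "(\<Prod>j<n. E j (Poly_Mapping.lookup m' j)) = E i (Poly_Mapping.lookup m' i) *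
        (\<Prod>j\<in>{..<n} - {i}. E j (Poly_Mapping.lookup m' j))"
      by (rule prod.remove) (use assms in auto)
    also have "(\<Prod>j\<in>{..<n} - {i}. E j (Poly_Mapping.lookup m' j)) =
        (\<Prod>j\<in>{..<n} - {i}. E j (Poly_Mapping.lookup m j))"
      by (rule prod.cong) (use that in auto)
    finally show ?thesis by (simp add: quadric_basis_def E_def)
  qed
  have E_even: "var i * E i k = E i (Suc k)" if "even k" for k
  proof -
    from that obtain a where "k = 2 * a" by (rule evenE)
    then show ?thesis by (simp add: E_def)
  qed
  have E_odd: "var i * E i k = E i (Suc k) + E i (k - 1) * var n ^ 2" if "odd k" for k
  proof -
    from that obtain a where "k = 2 * a + 1" by (rule oddE)
    then have "k mod 2 = 1" "k div 2 = a" "Suc k mod 2 = 0" "Suc k div 2 = Suc a"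
      "(k - 1) mod 2 = 0" "(k - 1) div 2 = a"
      by auto
    then show ?thesis
      by (simp add: E_def quadric_def algebra_simps power2_eq_square)
  qed
  let ?R = "\<Prod>j\<in>{..<n} - {i}. E j (Poly_Mapping.lookup m j)"
  have up: "quadric_basis n (var_monom i + m) =
      E i (Suc (Poly_Mapping.lookup m i)) * ?R * var n ^ Poly_Mapping.lookup m n"
    by (subst basis) (use assms in \<open>auto simp: lookup_add lookup_var_monom\<close>)
  have down: "quadric_basis n (m - var_monom i + (var_monom n + var_monom n)) =
      E i (Poly_Mapping.lookup m i - 1) * ?R * var n ^ (Poly_Mapping.lookup m n + 2)"
    by (subst basis) (use assms in \<open>auto simp: lookup_add lookup_minus lookup_var_monom\<close>)
  have "var i * quadric_basis n m =
      (var i * E i (Poly_Mapping.lookup m i)) * ?R * var n ^ Poly_Mapping.lookup m n"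
    by (subst basis) (auto simp: mult_ac)
  also have "var i * E i (Poly_Mapping.lookup m i) = (if even (Poly_Mapping.lookup m i)
      then E i (Suc (Poly_Mapping.lookup m i))
      else E i (Suc (Poly_Mapping.lookup m i)) + E i (Poly_Mapping.lookup m i - 1) * var n ^ 2)"
    using E_even E_odd by simp
  finally show ?thesis
    by (simp only: up down distrib_right distrib_left power_add mult_ac
        split: if_split) (simp add: distrib_left mult_ac)
qed

lemma quadric_comb_surj:
  assumes "f \<in> carrier (poly_ring n)"
  obtains g where "Poly_Mapping.keys g \<subseteq> monomials n" and "f = quadric_comb n g"
proof -
  define R where "R = quadric_comb n ` {g. Poly_Mapping.keys g \<subseteq> monomials n}"
  have R_add: "f + g \<in> R" if "f \<in> R" "g \<in> R" for f g
    using that quadric_comb_add[of n] poly_ring_add_closed[of _ n]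
    unfolding R_def image_iff by (metis mem_Collect_eq)
  have R_basis: "Poly_Mapping.single 0 c * quadric_basis n m \<in> R" if "m \<in> monomials n" for c m
    using that by (auto simp: R_def image_iff simp flip: quadric_comb_single
        intro!: exI[of _ "Poly_Mapping.single m c"] split: if_splits)
  have R_var_basis: "var i * (Poly_Mapping.single 0 c * quadric_basis n m) \<in> R"
    if "i \<le> n" "m \<in> monomials n" for i c m
  proof -
    have "m - var_monom i \<in> monomials n"
      using that(2) by (auto simp: monomials_def in_keys_iff lookup_minus subset_iff)
    then have "Poly_Mapping.single 0 c * (var i * quadric_basis n m) \<in> R"
      using that by (cases "i = n")
        (auto simp: var_last_mult_quadric_basis var_mult_quadric_basis distrib_left
          intro!: R_add R_basis monomials_add var_monom_in_monomials)
    then show ?thesis by (simp only: mult.left_commute)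
  qed
  have R_var: "var i * f \<in> R" if i: "i \<le> n" and "f \<in> R" for i f
  proof -
    from \<open>f \<in> R\<close> obtain g where g: "Poly_Mapping.keys g \<subseteq> monomials n" and f: "f = quadric_comb n g"
      by (auto simp: R_def)
    from g have "var i * quadric_comb n g \<in> R"
    proof (induction g rule: poly_mapping_induct_add)
      case zero
      then show ?case using R_basis[of 0 0] by (simp add: zero_in_monomials quadric_comb_def)
    next
      case (single m c)
      then show ?case using R_var_basis i by (simp add: quadric_comb_single)
    next
      case (add f g)
      then show ?case by (simp add: quadric_comb_add distrib_left R_add)
    qed
    then show ?thesis by (simp add: f)
  qed
  have "f \<in> R"
    using assms
  proof (induction rule: poly_ring_induct)
    case (const c)
    then show ?case using R_basis[of 0 c] by (simp add: zero_in_monomials)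
  qed (use R_var R_add in auto)
  then show ?thesis using that by (auto simp: R_def)
qed


section \<open>Initial terms of the adapted basis\<close>

text \<open>\<open>f\<close> is monic with leading monomial \<open>m\<close>.\<close>

definition monic_leading :: "nat \<Rightarrow> monom rel \<Rightarrow> mpoly \<Rightarrow> monom \<Rightarrow> bool" where
  "monic_leading n r f m \<longleftrightarrow> Poly_Mapping.keys f \<subseteq> monomials n \<and> Poly_Mapping.lookup f m = 1 \<and>
     (\<forall>k\<in>Poly_Mapping.keys f. (k, m) \<in> r)"

context
  fixes n :: nat and r :: "monom rel"
  assumes ord: "monomial_ordering n r"
begin

lemma ordering_linear:
  shows ordering_refl_on: "refl_on (monomials n) r" and ordering_trans': "trans r"
    and ordering_antisym': "antisym r" and ordering_total_on: "total_on (monomials n) r"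
  using ord unfolding monomial_ordering_def well_order_on_def linear_order_on_def
    partial_order_on_def preorder_on_def by blast+

lemmas ordering_refl = refl_onD[OF ordering_refl_on]
lemmas ordering_trans = transD[OF ordering_trans']
lemmas ordering_antisym = antisymD[OF ordering_antisym']

lemma ordering_total: "a \<in> monomials n \<Longrightarrow> b \<in> monomials n \<Longrightarrow> (a, b) \<in> r \<or> (b, a) \<in> r"
  using ordering_total_on ordering_refl by (cases "a = b") (simp_all add: total_on_def)

lemma ordering_add:
  assumes "(a, b) \<in> r" "(a', b') \<in> r"
    and "a \<in> monomials n" "b \<in> monomials n" "a' \<in> monomials n" "b' \<in> monomials n"
  shows "(a + a', b + b') \<in> r"
proof -
  have "(a + a', b + a') \<in> r" "(a' + b, b' + b) \<in> r"
    using ord assms unfolding monomial_ordering_def by blast+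
  then show ?thesis
    using ordering_trans by (metis add.commute)
qed

lemma initial_monom_eqI:
  assumes "m \<in> Poly_Mapping.keys f" "\<And>k. k \<in> Poly_Mapping.keys f \<Longrightarrow> (k, m) \<in> r"
  shows "initial_monom r f = m"
  unfolding initial_monom_def using assms ordering_antisym by (intro the_equality) auto

lemma ordering_max_exists:
  assumes "finite A" "A \<noteq> {}" "A \<subseteq> monomials n"
  obtains m where "m \<in> A" "\<And>k. k \<in> A \<Longrightarrow> (k, m) \<in> r"
proof -
  have "\<exists>m\<in>A. \<forall>k\<in>A. (k, m) \<in> r"
    using assms
  proof (induction A rule: finite_ne_induct)
    case (singleton x)
    then show ?case by (simp add: ordering_refl)
  next
    case (insert x A)
    then obtain m where m: "m \<in> A" "\<forall>k\<in>A. (k, m) \<in> r" by auto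
    show ?case
    proof (cases "(x, m) \<in> r")
      case True
      then show ?thesis using m by auto
    next
      case False
      then have "(m, x) \<in> r"
        using ordering_total insert.prems m(1) by blast
      then have "(k, x) \<in> r" if "k \<in> insert x A" for k
        using that m(2) ordering_trans ordering_refl insert.prems by blast
      then show ?thesis by blast
    qed
  qed
  then show ?thesis using that by blast
qed

lemma monic_leading_in_monomials: "monic_leading n r f m \<Longrightarrow> m \<in> monomials n"
  by (auto simp: monic_leading_def in_keys_iff subset_iff)

lemma monic_leading_mult:
  assumes "monic_leading n r f a" "monic_leading n r g b"
  shows "monic_leading n r (f * g) (a + b)"
proof -
  have ab: "a \<in> monomials n" "b \<in> monomials n"
    using assms monic_leading_in_monomials by blast+
  have f: "Poly_Mapping.keys f \<subseteq> monomials n" "Poly_Mapping.lookup f a = 1"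
      "\<And>k. k \<in> Poly_Mapping.keys f \<Longrightarrow> (k, a) \<in> r"
    and g: "Poly_Mapping.keys g \<subseteq> monomials n" "Poly_Mapping.lookup g b = 1"
      "\<And>k. k \<in> Poly_Mapping.keys g \<Longrightarrow> (k, b) \<in> r"
    using assms by (auto simp: monic_leading_def)
  define f' where "f' = f - Poly_Mapping.single a 1"
  define g' where "g' = g - Poly_Mapping.single b 1"
  have f': "k \<in> Poly_Mapping.keys f \<and> k \<noteq> a" if "k \<in> Poly_Mapping.keys f'" for k
    using that f(2) by (auto simp: f'_def in_keys_iff lookup_minus lookup_single when_def split: if_splits)
  have g': "k \<in> Poly_Mapping.keys g \<and> k \<noteq> b" if "k \<in> Poly_Mapping.keys g'" for k
    using that g(2) by (auto simp: g'_def in_keys_iff lookup_minus lookup_single when_def split: if_splits)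
  have fg: "f * g = Poly_Mapping.single (a + b) 1 + (Poly_Mapping.single a 1 * g' + f' * g)"
    by (simp add: f'_def g'_def algebra_simps mult_single)
  have "a + b \<notin> Poly_Mapping.keys (Poly_Mapping.single a 1 * g')"
  proof
    assume "a + b \<in> Poly_Mapping.keys (Poly_Mapping.single a 1 * g')"
    then obtain k where "a + b = a + k" "k \<in> Poly_Mapping.keys g'"
      using keys_mult[of "Poly_Mapping.single a 1" g'] by auto
    then show False using g' by auto
  qed
  moreover have "a + b \<notin> Poly_Mapping.keys (f' * g)"
  proof
    assume "a + b \<in> Poly_Mapping.keys (f' * g)"
    then obtain k l where kl: "a + b = k + l" "k \<in> Poly_Mapping.keys f'" "l \<in> Poly_Mapping.keys g"
      using keys_mult[of f' g] by auto
    have k: "(k, a) \<in> r" "k \<noteq> a" "k \<in> monomials n" using f' f kl(2) by auto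
    \<comment> \<open>\<open>k < a\<close> and \<open>l \<le> b\<close> give \<open>k + l \<le> k + b \<le> a + b = k + l\<close>, hence \<open>k = a\<close> by cancellation.\<close>
    have "(k + l, k + b) \<in> r" "(k + b, a + b) \<in> r"
      by (intro ordering_add ordering_refl; use k kl(3) g ab in auto)+
    then have "k + b = a + b"
      using kl(1) ordering_antisym by metis
    then show False using k by simp
  qed
  ultimately have "Poly_Mapping.lookup (f * g) (a + b) = 1"
    unfolding fg by (simp add: lookup_add in_keys_iff)
  moreover have "(k, a + b) \<in> r" if "k \<in> Poly_Mapping.keys (f * g)" for k
    using that keys_mult[of f g] f g ab by (auto intro!: ordering_add)
  ultimately show ?thesis
    using f g poly_ring_mult_closed by (auto simp: monic_leading_def)
qed

lemma monic_leading_one: "monic_leading n r 1 0"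
  by (simp add: monic_leading_def zero_in_monomials ordering_refl)

lemma monic_leading_var: "i \<le> n \<Longrightarrow> monic_leading n r (var i) (var_monom i)"
  by (simp add: monic_leading_def var_def var_monom_in_monomials ordering_refl)

lemma monic_leading_power:
  assumes "monic_leading n r f (Poly_Mapping.single i a)"
  shows "monic_leading n r (f ^ k) (Poly_Mapping.single i (k * a))"
  by (induction k)
    (use assms monic_leading_one monic_leading_mult in \<open>auto simp: single_add\<close>)

lemma monic_leading_prod:
  assumes "\<And>i. i \<in> A \<Longrightarrow> monic_leading n r (f i) (m i)"
  shows "monic_leading n r (\<Prod>i\<in>A. f i) (\<Sum>i\<in>A. m i)"
  using assms
  by (induction A rule: infinite_finite_induct) (auto intro: monic_leading_one monic_leading_mult)

context
  assumes var_last_least: "\<And>i. i < n \<Longrightarrow> (var_monom n, var_monom i) \<in> r"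
begin

lemma monic_leading_quadric:
  assumes "i < n"
  shows "monic_leading n r (quadric n i) (Poly_Mapping.single i 2)"
proof -
  have sq: "var j ^ 2 = Poly_Mapping.single (var_monom j + var_monom j) 1" for j
    by (simp add: var_def power2_eq_square mult_single)
  have two: "Poly_Mapping.single j 2 = var_monom j + var_monom j" for j
    by (simp add: var_monom_def numeral_2_eq_2 flip: single_add)
  have ne: "var_monom n + var_monom n \<noteq> var_monom i + var_monom i"
    using assms by (metis two lookup_single_eq lookup_single_not_eq less_irrefl zero_neq_numeral)
  have mon: "var_monom j \<in> monomials n" if "j \<le> n" for j
    using that by (rule var_monom_in_monomials)
  have "(var_monom n + var_monom n, var_monom i + var_monom i) \<in> r"
    by (intro ordering_add) (use var_last_least mon assms in auto)
  then have "(k, var_monom i + var_monom i) \<in> r" if "k \<in> Poly_Mapping.keys (quadric n i)" for k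
    using that keys_diff[of "var i ^ 2" "var n ^ 2"] assms
    by (auto simp: quadric_def sq intro!: ordering_refl monomials_add mon)
  moreover have "Poly_Mapping.lookup (quadric n i) (var_monom i + var_monom i) = 1"
    using ne by (simp add: quadric_def sq lookup_minus lookup_single when_def)
  ultimately show ?thesis
    using poly_ring_quadric_closed[of i n] assms by (auto simp: monic_leading_def two)
qed

lemma monic_leading_quadric_prod:
  "monic_leading n r (\<Prod>i<n. quadric n i ^ a i) (\<Sum>i<n. Poly_Mapping.single i (2 * a i))"
  by (rule monic_leading_prod)
    (use monic_leading_quadric monic_leading_power in \<open>fastforce simp: mult.commute[of 2]\<close>)

lemma monic_leading_quadric_basis:
  assumes "m \<in> monomials n"
  shows "monic_leading n r (quadric_basis n m) m"
proof -
  have var: "monic_leading n r (var i ^ k) (Poly_Mapping.single i k)" if "i \<le> n" for i k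
    using monic_leading_power[of "var i" i 1 k] monic_leading_var[OF that] by (simp add: var_monom_def)
  have "monic_leading n r (quadric_basis n m)
      ((\<Sum>i<n. Poly_Mapping.single i (Poly_Mapping.lookup m i mod 2) +
        Poly_Mapping.single i (Poly_Mapping.lookup m i div 2 * 2)) +
       Poly_Mapping.single n (Poly_Mapping.lookup m n))"
    unfolding quadric_basis_def
    by (intro monic_leading_mult monic_leading_prod monic_leading_power monic_leading_quadric var) auto
  moreover have "(\<Sum>i<n. Poly_Mapping.single i (Poly_Mapping.lookup m i mod 2) +
        Poly_Mapping.single i (Poly_Mapping.lookup m i div 2 * 2)) +
       Poly_Mapping.single n (Poly_Mapping.lookup m n) =
      (\<Sum>i\<le>n. Poly_Mapping.single i (Poly_Mapping.lookup m i))"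
    by (simp flip: single_add add: lessThan_Suc_atMost[symmetric])
  moreover have "\<dots> = m"
    using assms by (intro poly_mapping_eqI)
      (auto simp: lookup_sum lookup_single when_def monomials_def in_keys_iff subset_iff)
  ultimately show ?thesis by simp
qed

text \<open>Since the adapted basis is triangular, no cancellation of leading monomials occurs in a linear
  combination: its initial monomial is the largest index that occurs.\<close>

lemma initial_monom_quadric_comb:
  assumes "Poly_Mapping.keys g \<subseteq> monomials n" and "quadric_comb n g \<noteq> 0"
  shows "initial_monom r (quadric_comb n g) \<in> Poly_Mapping.keys g"
proof -
  let ?f = "quadric_comb n g"
  have "g \<noteq> 0" using assms(2) by (auto simp: quadric_comb_def)
  then obtain m where m: "m \<in> Poly_Mapping.keys g" "\<And>k. k \<in> Poly_Mapping.keys g \<Longrightarrow> (k, m) \<in> r"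
    using ordering_max_exists[of "Poly_Mapping.keys g"] assms(1) by auto
  have lead: "monic_leading n r (quadric_basis n k) k" if "k \<in> Poly_Mapping.keys g" for k
    using monic_leading_quadric_basis that assms(1) by auto
  have lookup: "Poly_Mapping.lookup ?f l = (\<Sum>k\<in>Poly_Mapping.keys g.
      Poly_Mapping.lookup g k * Poly_Mapping.lookup (quadric_basis n k) l)" for l
    by (simp add: quadric_comb_def lookup_sum lookup_const_mult)
  have "Poly_Mapping.lookup (quadric_basis n k) m = 0" if "k \<in> Poly_Mapping.keys g" "k \<noteq> m" for k
  proof (rule ccontr)
    assume "\<not> ?thesis"
    then have "(m, k) \<in> r"
      using lead[OF that(1)] by (simp add: monic_leading_def in_keys_iff)
    then show False
      using m(2)[OF that(1)] that(2) ordering_antisym by blast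
  qed
  then have "Poly_Mapping.lookup ?f m = (\<Sum>k\<in>Poly_Mapping.keys g.
      if k = m then Poly_Mapping.lookup g m * Poly_Mapping.lookup (quadric_basis n m) m else 0)"
    unfolding lookup by (intro sum.cong) auto
  also have "\<dots> = Poly_Mapping.lookup g m"
    using m(1) lead[OF m(1)] by (simp add: sum.delta monic_leading_def)
  finally have "m \<in> Poly_Mapping.keys ?f"
    using m(1) by (simp add: in_keys_iff)
  moreover have "(l, m) \<in> r" if "l \<in> Poly_Mapping.keys ?f" for l
  proof -
    have "\<exists>k\<in>Poly_Mapping.keys g. l \<in> Poly_Mapping.keys (quadric_basis n k)"
      using that lookup[of l] by (auto simp: in_keys_iff intro: sum.neutral ccontr)
    then obtain k where k: "k \<in> Poly_Mapping.keys g" "l \<in> Poly_Mapping.keys (quadric_basis n k)"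
      by blast
    then have "(l, k) \<in> r"
      using lead by (auto simp: monic_leading_def)
    then show ?thesis
      using m(2)[OF k(1)] ordering_trans by blast
  qed
  ultimately show ?thesis
    using initial_monom_eqI m(1) by metis
qed

lemma initial_term_quadric_prod:
  "initial_term r (\<Prod>i<n. quadric n i ^ a i) =
     Poly_Mapping.single (\<Sum>i<n. Poly_Mapping.single i (2 * a i)) 1"
proof -
  let ?f = "\<Prod>i<n. quadric n i ^ a i" and ?m = "\<Sum>i<n. Poly_Mapping.single i (2 * a i)"
  have lead: "monic_leading n r ?f ?m" by (rule monic_leading_quadric_prod)
  then have "?m \<in> Poly_Mapping.keys ?f" by (simp add: monic_leading_def in_keys_iff)
  moreover from this have "initial_monom r ?f = ?m"
    using lead by (intro initial_monom_eqI) (auto simp: monic_leading_def)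
  moreover have "?f \<noteq> 0"
    using calculation(1) by (metis empty_iff keys_zero)
  ultimately show ?thesis
    using lead by (simp only: initial_term_def monic_leading_def if_False)
qed

end

end


section \<open>Independence of characters\<close>

text \<open>Dedekind's lemma: pairwise distinct multiplicative functions \<open>\<chi> m\<close> on a set \<open>M\<close> that is closed
  under an operation \<open>\<star>\<close>, normalised at some \<open>e\<close>, are linearly independent.\<close>

lemma characters_independent:
  fixes \<chi> :: "'m \<Rightarrow> 'x \<Rightarrow> 'a::idom" and star :: "'x \<Rightarrow> 'x \<Rightarrow> 'x"
  assumes "finite A"
    and closed: "\<And>x y. x \<in> M \<Longrightarrow> y \<in> M \<Longrightarrow> star x y \<in> M"
    and hom: "\<And>m x y. x \<in> M \<Longrightarrow> y \<in> M \<Longrightarrow> \<chi> m (star x y) = \<chi> m x * \<chi> m y"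
    and e: "e \<in> M" "\<And>m. \<chi> m e = 1"
    and distinct: "\<And>m m'. m \<in> A \<Longrightarrow> m' \<in> A \<Longrightarrow> m \<noteq> m' \<Longrightarrow> \<exists>x\<in>M. \<chi> m x \<noteq> \<chi> m' x"
    and zero: "\<And>x. x \<in> M \<Longrightarrow> (\<Sum>m\<in>A. c m * \<chi> m x) = 0"
    and "m \<in> A"
  shows "c m = 0"
  using \<open>finite A\<close> distinct zero \<open>m \<in> A\<close>
proof (induction A arbitrary: c m rule: finite_induct)
  case (insert z A)
  have A: "c m = 0" if "m \<in> A" for m
  proof -
    obtain y where y: "y \<in> M" "\<chi> m y \<noteq> \<chi> z y"
      using insert.prems(1)[of m z] insert.hyps(2) \<open>m \<in> A\<close> by blast
    \<comment> \<open>Subtracting \<open>\<chi> z y\<close> times the relation at \<open>x\<close> from the relation at \<open>x \<star> y\<close> removes \<open>z\<close>.\<close>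
    have "(\<Sum>k\<in>A. c k * (\<chi> k y - \<chi> z y) * \<chi> k x) = 0" if "x \<in> M" for x
    proof -
      have "(\<Sum>k\<in>insert z A. c k * \<chi> k (star x y)) - \<chi> z y * (\<Sum>k\<in>insert z A. c k * \<chi> k x) = 0"
        using insert.prems(2)[OF closed] insert.prems(2) that y by simp
      then have "(\<Sum>k\<in>insert z A. c k * (\<chi> k y - \<chi> z y) * \<chi> k x) = 0"
        by (simp only: hom[OF that y(1)] sum_distrib_left flip: sum_subtractf)
          (simp add: algebra_simps)
      then show ?thesis using insert.hyps by simp
    qed
    then have "c m * (\<chi> m y - \<chi> z y) = 0"
      by (intro insert.IH[where c = "\<lambda>k. c k * (\<chi> k y - \<chi> z y)"]) (use insert.prems(1) that in auto)
    then show ?thesis using y by simp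
  qed
  then have "c z = 0"
    using insert.prems(2)[OF e(1)] insert.hyps by (simp add: e(2))
  then show ?case using A insert.prems(3) by blast
qed simp


section \<open>Vanishing order along lines\<close>

text \<open>Along the line through \<open>c (s\<^sub>0, \<dots>, s\<^sub>n)\<close> with direction \<open>w\<close>, where the \<open>s\<^sub>i\<close> are signs, \<open>s\<^sub>n = 1\<close>
  and \<open>w\<^sub>n = 0\<close>, the quadric \<open>Q\<^sub>i\<close> becomes \<open>t (2 c s\<^sub>i w\<^sub>i + w\<^sub>i\<^sup>2 t)\<close>.\<close>

definition line :: "complex \<Rightarrow> (nat \<Rightarrow> complex) \<Rightarrow> (nat \<Rightarrow> complex) \<Rightarrow> nat \<Rightarrow> complex poly" where
  "line c s w i = [:c * s i, w i:]"

lemma subst_quadric_basis: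
  assumes s: "\<And>i. s i = 1 \<or> s i = - 1" "s n = 1" and "w n = 0"
  shows "subst (line c s w) (quadric_basis n m) =
    [:0, 1:] ^ quadric_degree n m *
    ((\<Prod>i<n. line c s w i ^ (Poly_Mapping.lookup m i mod 2) *
       [:2 * c * s i * w i, w i ^ 2:] ^ (Poly_Mapping.lookup m i div 2)) * [:c:] ^ Poly_Mapping.lookup m n)"
proof -
  have "s i * s i = 1" for i using s(1)[of i] by auto
  then have "c * s i * (c * s i) = c * c" for i
    by (metis mult.assoc mult.commute mult.right_neutral)
  then have quadric: "subst (line c s w) (quadric n i) = [:0, 1:] * [:2 * c * s i * w i, w i ^ 2:]" for i
    using assms by (simp add: subst_quadric line_def power2_eq_square algebra_simps)
  have "[:0, 1:] ^ quadric_degree n m = (\<Prod>i<n. [:0, 1 :: complex:] ^ (Poly_Mapping.lookup m i div 2))"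
    by (simp add: quadric_degree_def power_sum)
  moreover have "line c s w n = [:c:]"
    using assms by (simp add: line_def)
  ultimately show ?thesis
    unfolding quadric_basis_def subst_mult subst_prod subst_power quadric subst_var power_mult_distrib
    by (simp only: prod.distrib mult_ac)
qed

text \<open>A combination of adapted basis elements whose restrictions to all of these lines vanish to order
  \<open>d\<close> at \<open>t = 0\<close> involves only basis elements with at least \<open>d\<close> factors \<open>Q\<^sub>i\<close>. The lowest possible
  coefficients in \<open>t\<close> are, after the substitution \<open>w\<^sub>i = u\<^sub>i / (2 c s\<^sub>i)\<close>, characters in
  \<open>(c, s, u)\<close> from which the exponents of the basis elements can be recovered.\<close>

lemma quadric_degree_ge:
  assumes g: "Poly_Mapping.keys g \<subseteq> monomials n"
    and dvd: "\<And>c s w. c \<noteq> 0 \<Longrightarrow> (\<And>i. s i = 1 \<or> s i = - 1) \<Longrightarrow> s n = 1 \<Longrightarrow> w n = 0 \<Longrightarrow>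
      [:0, 1:] ^ d dvd subst (line c s w) (quadric_comb n g)"
    and "m \<in> Poly_Mapping.keys g"
  shows "d \<le> quadric_degree n m"
proof (rule ccontr)
  assume less: "\<not> ?thesis"
  define k where "k = Min (quadric_degree n ` Poly_Mapping.keys g)"
  define A where "A = {m \<in> Poly_Mapping.keys g. quadric_degree n m = k}"
  have k_le: "k \<le> quadric_degree n m" if "m \<in> Poly_Mapping.keys g" for m
    using that by (simp add: k_def)
  have "k < d" using k_le[OF assms(3)] less by simp
  have "k \<in> quadric_degree n ` Poly_Mapping.keys g"
    unfolding k_def by (rule Min_in) (use assms(3) in auto)
  then obtain m0 where m0: "m0 \<in> A" by (auto simp: A_def)
  define M :: "(complex \<times> (nat \<Rightarrow> complex) \<times> (nat \<Rightarrow> complex)) set"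
    where "M = {(c, s, u). c \<noteq> 0 \<and> (\<forall>i. s i = 1 \<or> s i = - 1) \<and> s n = 1 \<and> u n = 0}"
  define \<chi> :: "monom \<Rightarrow> complex \<times> (nat \<Rightarrow> complex) \<times> (nat \<Rightarrow> complex) \<Rightarrow> complex"
    where "\<chi> m = (\<lambda>(c, s, u). (\<Prod>i<n. (c * s i) ^ (Poly_Mapping.lookup m i mod 2) *
      u i ^ (Poly_Mapping.lookup m i div 2)) * c ^ Poly_Mapping.lookup m n)" for m
  define star :: "complex \<times> (nat \<Rightarrow> complex) \<times> (nat \<Rightarrow> complex) \<Rightarrow>
      complex \<times> (nat \<Rightarrow> complex) \<times> (nat \<Rightarrow> complex) \<Rightarrow> complex \<times> (nat \<Rightarrow> complex) \<times> (nat \<Rightarrow> complex)"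
    where "star = (\<lambda>(c, s, u) (c', s', u'). (c * c', \<lambda>i. s i * s' i, \<lambda>i. u i * u' i))"
  have zero: "(\<Sum>m\<in>A. Poly_Mapping.lookup g m * \<chi> m x) = 0" if "x \<in> M" for x
  proof -
    obtain c s u where x: "x = (c, s, u)" by (cases x)
    have csu: "c \<noteq> 0" "\<And>i. s i = 1 \<or> s i = - 1" "s n = 1" "u n = 0"
      using \<open>x \<in> M\<close> by (auto simp: M_def x)
    have s0: "s i \<noteq> 0" for i using csu(2)[of i] by auto
    define w where "w i = u i / (2 * c * s i)" for i
    have "w n = 0" using csu by (simp add: w_def)
    note basis = subst_quadric_basis[where s = s and n = n and w = w, OF csu(2,3) \<open>w n = 0\<close>]
    have coeff_basis: "coeff (subst (line c s w) (quadric_basis n m)) k =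
        (if quadric_degree n m = k then \<chi> m x else 0)" if "m \<in> Poly_Mapping.keys g" for m
    proof -
      have shift: "coeff ([:0, 1:] ^ l * q) k = (if l = k then poly q 0 else 0)"
        if "k \<le> l" for l and q :: "complex poly"
        using that by (simp flip: monom_altdef[where c = "1::complex", simplified]
            add: coeff_monom_mult poly_0_coeff_0)
      show ?thesis
        unfolding basis shift[OF k_le[OF that]] using csu(1) s0
        by (simp add: \<chi>_def x poly_prod poly_power line_def w_def mult.assoc)
    qed
    have "coeff (subst (line c s w) (quadric_comb n g)) k = 0"
    proof -
      obtain q where "subst (line c s w) (quadric_comb n g) = [:0, 1:] ^ d * q"
        using dvd[of c s w] csu \<open>w n = 0\<close> by blast
      then show ?thesis
        using \<open>k < d\<close> by (simp flip: monom_altdef[where c = "1::complex", simplified]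
            add: coeff_monom_mult)
    qed
    moreover have "coeff (subst (line c s w) (quadric_comb n g)) k =
        (\<Sum>m\<in>Poly_Mapping.keys g. Poly_Mapping.lookup g m *
          (if quadric_degree n m = k then \<chi> m x else 0))"
      by (simp add: quadric_comb_def subst_sum subst_mult coeff_sum coeff_basis)
    moreover have "\<dots> = (\<Sum>m\<in>A. Poly_Mapping.lookup g m * \<chi> m x)"
      unfolding A_def by (simp add: sum.inter_filter[symmetric] if_distrib cong: if_cong)
    ultimately show ?thesis by simp
  qed
  have distinct: "\<exists>x\<in>M. \<chi> m x \<noteq> \<chi> m' x" if "m \<in> A" "m' \<in> A" "m \<noteq> m'" for m m'
  proof (rule ccontr)
    assume "\<not> ?thesis"
    then have eq: "\<chi> m x = \<chi> m' x" if "x \<in> M" for x using that by blast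
    \<comment> \<open>The exponents are read off from values: \<open>e\<^sub>j\<close> by setting \<open>s\<^sub>j = - 1\<close>, \<open>a\<^sub>j\<close> by setting
      \<open>u\<^sub>j = 2\<close>, and finally the exponent of \<open>x\<^sub>n\<close> by setting \<open>c = 2\<close>, the remaining
      entries being \<open>1\<close>, except that \<open>u\<^sub>i = 0\<close> for \<open>i \<ge> n\<close>.\<close>
    have mod: "Poly_Mapping.lookup m j mod 2 = Poly_Mapping.lookup m' j mod 2"
      and div: "Poly_Mapping.lookup m j div 2 = Poly_Mapping.lookup m' j div 2" if "j < n" for j
    proof -
      have sgn: "\<chi> l (1, \<lambda>i. if i = j then - 1 else 1, \<lambda>i. if i < n then 1 else 0) =
          (- 1) ^ (Poly_Mapping.lookup l j mod 2)" for l
      proof -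
        have "\<chi> l (1, \<lambda>i. if i = j then - 1 else 1, \<lambda>i. if i < n then 1 else 0) =
            (\<Prod>i<n. if i = j then (- 1) ^ (Poly_Mapping.lookup l j mod 2) else 1)"
          unfolding \<chi>_def prod.case power_one mult_1_right by (rule prod.cong) auto
        then show ?thesis using that by simp
      qed
      have "(- 1 :: complex) ^ (Poly_Mapping.lookup m j mod 2) = (- 1) ^ (Poly_Mapping.lookup m' j mod 2)"
        unfolding sgn[symmetric] by (rule eq) (use that in \<open>auto simp: M_def\<close>)
      then show "Poly_Mapping.lookup m j mod 2 = Poly_Mapping.lookup m' j mod 2"
        by (cases "even (Poly_Mapping.lookup m j)"; cases "even (Poly_Mapping.lookup m' j)")
          (simp_all add: mod_2_eq_odd)
      have two: "\<chi> l (1, \<lambda>i. 1, \<lambda>i. if i < n then if i = j then 2 else 1 else 0) =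
          2 ^ (Poly_Mapping.lookup l j div 2)" for l
      proof -
        have "\<chi> l (1, \<lambda>i. 1, \<lambda>i. if i < n then if i = j then 2 else 1 else 0) =
            (\<Prod>i<n. if i = j then 2 ^ (Poly_Mapping.lookup l j div 2) else 1)"
          unfolding \<chi>_def prod.case power_one mult_1_right by (rule prod.cong) auto
        then show ?thesis using that by simp
      qed
      have "(2 :: complex) ^ (Poly_Mapping.lookup m j div 2) = 2 ^ (Poly_Mapping.lookup m' j div 2)"
        unfolding two[symmetric] by (rule eq) (auto simp: M_def)
      then have "(of_nat (2 ^ (Poly_Mapping.lookup m j div 2)) :: complex) =
          of_nat (2 ^ (Poly_Mapping.lookup m' j div 2))"
        by simp
      then show "Poly_Mapping.lookup m j div 2 = Poly_Mapping.lookup m' j div 2"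
        by (simp only: of_nat_eq_iff) simp
    qed
    have first: "Poly_Mapping.lookup m j = Poly_Mapping.lookup m' j" if "j < n" for j
      using mod[OF that] div[OF that] by (metis div_mult_mod_eq)
    have "\<chi> l (2, \<lambda>i. 1, \<lambda>i. if i < n then 1 else 0) =
        (\<Prod>i<n. 2 ^ (Poly_Mapping.lookup l i mod 2)) * 2 ^ Poly_Mapping.lookup l n" for l
      unfolding \<chi>_def by simp
    moreover have "\<chi> m (2, \<lambda>i. 1, \<lambda>i. if i < n then 1 else 0) = \<chi> m' (2, \<lambda>i. 1, \<lambda>i. if i < n then 1 else 0)"
      by (rule eq) (simp add: M_def)
    ultimately have "(2 :: complex) ^ Poly_Mapping.lookup m n = 2 ^ Poly_Mapping.lookup m' n"
      using first by simp
    then have "(of_nat (2 ^ Poly_Mapping.lookup m n) :: complex) = of_nat (2 ^ Poly_Mapping.lookup m' n)"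
      by simp
    then have last: "Poly_Mapping.lookup m n = Poly_Mapping.lookup m' n"
      by (simp only: of_nat_eq_iff) simp
    have "m = m'"
    proof (rule poly_mapping_eqI)
      fix j
      have "Poly_Mapping.lookup l j = 0" if "l \<in> A" "j > n" for l
      proof -
        have "l \<in> monomials n" using g that(1) by (auto simp: A_def)
        then have "j \<notin> Poly_Mapping.keys l" using that(2) by (auto simp: monomials_def)
        then show ?thesis by (simp add: in_keys_iff)
      qed
      then show "Poly_Mapping.lookup m j = Poly_Mapping.lookup m' j"
        using first last \<open>m \<in> A\<close> \<open>m' \<in> A\<close> by (cases j n rule: linorder_cases) auto
    qed
    then show False using \<open>m \<noteq> m'\<close> by simp
  qed
  have "Poly_Mapping.lookup g m0 = 0"
  proof (rule characters_independent[where M = M and \<chi> = \<chi> and star = star and A = A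
        and e = "(1, \<lambda>_. 1, \<lambda>i. if i < n then 1 else 0)"])
    show "finite A" by (simp add: A_def)
    show "star x y \<in> M" if "x \<in> M" "y \<in> M" for x y
    proof -
      obtain c s u c' s' u' where xy: "x = (c, s, u)" "y = (c', s', u')"
        by (metis prod_cases3)
      have "s i = 1 \<or> s i = - 1" "s' i = 1 \<or> s' i = - 1" for i
        using that by (auto simp: M_def xy)
      then have "s i * s' i = 1 \<or> s i * s' i = - 1" for i
        by (metis minus_mult_minus mult_1 mult_1_right)
      then show ?thesis
        using that by (auto simp: M_def star_def xy)
    qed
    show "\<chi> m (star x y) = \<chi> m x * \<chi> m y" for m x y
      by (simp add: \<chi>_def star_def power_mult_distrib prod.distrib mult_ac split: prod.splits)
  qed (use zero distinct m0 in \<open>auto simp: M_def \<chi>_def\<close>)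
  then show False using m0 by (simp add: A_def in_keys_iff)
qed


section \<open>The fat points\<close>

lemma sign_points_nonempty: "sign_points n \<noteq> {}"
  unfolding sign_points_def by (auto intro!: exI[of _ "\<lambda>_. 1"])

lemma quadric_in_points_ideal:
  assumes "i < n"
  shows "quadric n i \<in> points_ideal n (sign_points n)"
proof -
  have sq: "var j ^ 2 = Poly_Mapping.single (Poly_Mapping.single j 2) 1" for j
    by (simp add: var_def var_monom_def power2_eq_square mult_single numeral_2_eq_2 flip: single_add)
  have "total_degree m = 2" if "m \<in> Poly_Mapping.keys (quadric n i)" for m
    using that keys_diff[of "var i ^ 2" "var n ^ 2"] by (auto simp: quadric_def sq total_degree_def)
  then have form: "is_form (quadric n i)"
    unfolding is_form_def by blast
  have eval: "eval_poly w (quadric n i) = w i ^ 2 - w n ^ 2" for w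
    using poly_subst[of "\<lambda>i. [:w i:]" "quadric n i" 0] by (simp add: subst_quadric poly_power)
  have "vanishes_at (quadric n i) P" if "P \<in> sign_points n" for P
  proof -
    from that obtain v where v: "P = proj_point n v" "v 0 = 1" "\<forall>i\<in>{1..n}. v i = 1 \<or> v i = - 1"
      unfolding sign_points_def by blast
    have "v j ^ 2 = 1" if "j \<le> n" for j
    proof -
      have "v j = 1 \<or> v j = - 1"
        using v that by (cases "j = 0") auto
      then show ?thesis by auto
    qed
    then show ?thesis
      using assms by (auto simp: vanishes_at_def v(1) proj_point_def eval power_mult_distrib)
  qed
  then have "quadric n i \<in> point_ideal n P" if "P \<in> sign_points n" for P
    unfolding point_ideal_def using that form poly_ring_quadric_closed[of i n] assms
    by (intro subsetD[OF ring.genideal_self[OF cring.axioms(1)[OF poly_ring_cring]]]) auto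
  then show ?thesis by (simp add: points_ideal_def)
qed

text \<open>A polynomial in the \<open>d\<close>-th power of the ideal of a point vanishes to order \<open>d\<close> along every
  line through a coordinate vector of that point.\<close>

lemma ideal_power_point_ideal_vanishing:
  assumes "f \<in> ideal_power n (point_ideal n P) d"
    and "restrict (\<lambda>i. poly (p i) 0) {..n} \<in> P"
  shows "[:0, 1:] ^ d dvd subst p f"
  using assms(1)
proof (induction d arbitrary: f)
  case (Suc d)
  have point: "[:0, 1:] dvd subst p h" if "h \<in> point_ideal n P" for h
  proof -
    have "ideal {h \<in> carrier (poly_ring n). [:0, 1:] dvd subst p h} (poly_ring n)"
      unfolding ideal_poly_ring_iff
      by (intro conjI ballI subsetI)
        (simp_all add: subst_add subst_mult poly_ring_add_closed poly_ring_mult_closed)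
    moreover have "[:0, 1:] dvd subst p h"
      if "h \<in> carrier (poly_ring n)" "vanishes_at h P" for h
    proof -
      have "poly (subst p h) 0 = eval_poly (restrict (\<lambda>i. poly (p i) 0) {..n}) h"
        unfolding poly_subst by (rule eval_poly_cong[of _ n]) (use that in auto)
      also have "\<dots> = 0"
        using that(2) assms(2) by (simp add: vanishes_at_def)
      finally show ?thesis by (simp add: poly_eq_0_iff_dvd)
    qed
    ultimately have "point_ideal n P \<subseteq> {h \<in> carrier (poly_ring n). [:0, 1:] dvd subst p h}"
      unfolding point_ideal_def
      by (intro ring.genideal_minimal[OF cring.axioms(1)[OF poly_ring_cring]]) auto
    then show ?thesis using that by blast
  qed
  have "f \<in> ideal_prod (poly_ring n) (ideal_power n (point_ideal n P) d) (point_ideal n P)"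
    using Suc.prems by (simp only: ideal_power_Suc)
  then show ?case
  proof (induction rule: ideal_prod.induct)
    case (prod i j)
    then show ?case
      using mult_dvd_mono[OF Suc.IH[OF prod(1)] point[OF prod(2)]]
      by (simp add: subst_mult mult.commute)
  next
    case (sum s1 s2)
    then show ?case by (simp add: subst_add)
  qed
qed simp

text \<open>Hence a polynomial in the ideal of the fat points is a combination of adapted basis elements with
  at least \<open>d\<close> factors \<open>Q\<^sub>i\<close>.\<close>

lemma fat_points_ideal_quadric_comb:
  assumes f: "f \<in> fat_points_ideal n (sign_points n) d"
  obtains g where "Poly_Mapping.keys g \<subseteq> monomials n" "f = quadric_comb n g"
    "\<forall>m\<in>Poly_Mapping.keys g. d \<le> quadric_degree n m"
proof -
  obtain P where "P \<in> sign_points n" using sign_points_nonempty by blast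
  then have "f \<in> carrier (poly_ring n)"
    using f ideal.Icarr[OF ideal_ideal_power[OF ideal_point_ideal]] unfolding fat_points_ideal_def
    by (meson INT_E)
  then obtain g where g: "Poly_Mapping.keys g \<subseteq> monomials n" "f = quadric_comb n g"
    by (rule quadric_comb_surj)
  have "[:0, 1:] ^ d dvd subst (line c s w) (quadric_comb n g)"
    if "c \<noteq> 0" "\<And>i. s i = 1 \<or> s i = - 1" for c s w
  proof -
    \<comment> \<open>In the coordinates with \<open>x\<^sub>0 = 1\<close> the point is \<open>s\<^sub>0 \<cdot> s\<close>, as \<open>s\<^sub>0\<^sup>2 = 1\<close>.\<close>
    define v where "v i = s 0 * s i" for i
    have sq: "s i * s i = 1" for i using that(2)[of i] by auto
    have "v i = 1 \<or> v i = - 1" for i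
      using that(2)[of i] that(2)[of 0] by (auto simp: v_def)
    then have "proj_point n v \<in> sign_points n"
      unfolding sign_points_def using sq by (intro CollectI exI[of _ v]) (auto simp: v_def)
    then have "f \<in> ideal_power n (point_ideal n (proj_point n v)) d"
      using f by (auto simp: fat_points_ideal_def)
    moreover have "restrict (\<lambda>i. poly (line c s w i) 0) {..n} \<in> proj_point n v"
    proof -
      have "c * s 0 \<noteq> 0" using that(1) that(2)[of 0] by auto
      moreover have "c * s 0 * v i = poly (line c s w i) 0" for i
        using sq[of 0] by (simp add: v_def line_def)
      ultimately show ?thesis unfolding proj_point_def by (intro CollectI exI[of _ "c * s 0"]) simp
    qed
    ultimately show ?thesis
      using ideal_power_point_ideal_vanishing g(2) by blast
  qed
  then have "\<forall>m\<in>Poly_Mapping.keys g. d \<le> quadric_degree n m"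
    using quadric_degree_ge[OF g(1)] by blast
  then show ?thesis by (rule that[OF g])
qed

lemma exists_le_sum_eq:
  fixes a :: "nat \<Rightarrow> nat"
  assumes "d \<le> (\<Sum>i<n. a i)"
  obtains b where "\<And>i. b i \<le> a i" and "(\<Sum>i<n. b i) = d"
proof -
  have "\<exists>b. (\<forall>i. b i \<le> a i) \<and> (\<Sum>i<n. b i) = d"
    using assms
  proof (induction d)
    case 0
    then show ?case by (intro exI[of _ "\<lambda>_. 0"]) simp
  next
    case (Suc d)
    then obtain b where b: "\<forall>i. b i \<le> a i" "(\<Sum>i<n. b i) = d" by auto
    then obtain j where j: "j < n" "b j < a j"
      using Suc.prems sum_mono[of "{..<n}" a b] by (force simp: not_less)
    have "(\<Sum>i<n. (b(j := Suc (b j))) i) = (\<Sum>i<n. b i + (if i = j then 1 else 0))"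
      by (rule sum.cong) auto
    also have "\<dots> = Suc d" using b j by (simp add: sum.distrib)
    finally show ?case
      using b j by (intro exI[of _ "b(j := Suc (b j))"]) auto
  qed
  then show ?thesis using that by blast
qed

lemma quadric_monomials_closed: "quadric_monomials n d \<subseteq> carrier (poly_ring n)"
proof -
  have "Poly_Mapping.keys (\<Prod>i<n. quadric n i ^ a i) \<subseteq> monomials n" for a
    by (intro poly_ring_prod_closed poly_ring_power_closed poly_ring_quadric_closed) auto
  then show ?thesis by (auto simp: quadric_monomials_def)
qed

lemma ideal_Idl:
  assumes "G \<subseteq> carrier (poly_ring n)"
  shows "ideal (Idl\<^bsub>poly_ring n\<^esub> G) (poly_ring n)" "G \<subseteq> Idl\<^bsub>poly_ring n\<^esub> G"
  using assms by (rule ring.genideal_ideal[OF cring.axioms(1)[OF poly_ring_cring]]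
      ring.genideal_self[OF cring.axioms(1)[OF poly_ring_cring]])+

lemma Idl_least:
  assumes "ideal I (poly_ring n)" "G \<subseteq> I"
  shows "Idl\<^bsub>poly_ring n\<^esub> G \<subseteq> I"
  using assms by (rule ring.genideal_minimal[OF cring.axioms(1)[OF poly_ring_cring]])

lemma quadric_basis_in_Idl:
  assumes "d \<le> quadric_degree n m"
  shows "quadric_basis n m \<in> Idl\<^bsub>poly_ring n\<^esub> (quadric_monomials n d)"
proof -
  obtain b where b: "\<And>i. b i \<le> Poly_Mapping.lookup m i div 2" "(\<Sum>i<n. b i) = d"
    using exists_le_sum_eq assms unfolding quadric_degree_def by blast
  let ?h = "(\<Prod>i<n. var i ^ (Poly_Mapping.lookup m i mod 2) *
    quadric n i ^ (Poly_Mapping.lookup m i div 2 - b i)) * var n ^ Poly_Mapping.lookup m n"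
  have "quadric n i ^ (Poly_Mapping.lookup m i div 2) =
      quadric n i ^ (Poly_Mapping.lookup m i div 2 - b i) * quadric n i ^ b i" for i
    using b(1)[of i] by (simp flip: power_add)
  then have "quadric_basis n m = ?h * (\<Prod>i<n. quadric n i ^ b i)"
    by (simp add: quadric_basis_def prod.distrib mult_ac)
  moreover have "(\<Prod>i<n. quadric n i ^ b i) \<in> Idl\<^bsub>poly_ring n\<^esub> (quadric_monomials n d)"
    using ideal_Idl(2)[OF quadric_monomials_closed] b(2) by (auto simp: quadric_monomials_def)
  moreover have "Poly_Mapping.keys ?h \<subseteq> monomials n"
    by (intro poly_ring_mult_closed poly_ring_prod_closed poly_ring_power_closed
      poly_ring_var_closed poly_ring_quadric_closed) auto
  ultimately show ?thesis
    using ideal_mult_closed[OF ideal_Idl(1)[OF quadric_monomials_closed]] by simp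
qed

lemma fat_points_ideal_subset_Idl:
  "fat_points_ideal n (sign_points n) d \<subseteq> Idl\<^bsub>poly_ring n\<^esub> (quadric_monomials n d)"
proof
  fix f assume "f \<in> fat_points_ideal n (sign_points n) d"
  then obtain g where g: "Poly_Mapping.keys g \<subseteq> monomials n" "f = quadric_comb n g"
      "\<forall>m\<in>Poly_Mapping.keys g. d \<le> quadric_degree n m"
    by (rule fat_points_ideal_quadric_comb)
  have I: "ideal (Idl\<^bsub>poly_ring n\<^esub> (quadric_monomials n d)) (poly_ring n)"
    by (rule ideal_Idl(1)[OF quadric_monomials_closed])
  then have "Poly_Mapping.single 0 c * quadric_basis n m \<in> Idl\<^bsub>poly_ring n\<^esub> (quadric_monomials n d)"
    if "m \<in> Poly_Mapping.keys g" for c m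
    using that g(3) by (intro ideal_mult_closed[OF I] quadric_basis_in_Idl poly_ring_const_closed) auto
  then show "f \<in> Idl\<^bsub>poly_ring n\<^esub> (quadric_monomials n d)"
    unfolding g(2) quadric_comb_def by (rule ideal_sum_closed[OF I])
qed

lemma Idl_subset_ideal_power:
  "Idl\<^bsub>poly_ring n\<^esub> (quadric_monomials n d) \<subseteq> ideal_power n (points_ideal n (sign_points n)) d"
proof (rule Idl_least)
  have I: "ideal (points_ideal n (sign_points n)) (poly_ring n)"
    by (rule ideal_points_ideal[OF sign_points_nonempty])
  then show "ideal (ideal_power n (points_ideal n (sign_points n)) d) (poly_ring n)"
    by (rule ideal_ideal_power)
  show "quadric_monomials n d \<subseteq> ideal_power n (points_ideal n (sign_points n)) d"
    using prod_powers_in_ideal_power[OF I, of "{..<n}" "quadric n"] quadric_in_points_ideal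
    by (auto simp: quadric_monomials_def)
qed

lemma ideal_power_points_ideal_subset:
  "ideal_power n (points_ideal n X) d \<subseteq> fat_points_ideal n X d"
  unfolding fat_points_ideal_def
proof (rule INT_greatest)
  fix P assume "P \<in> X"
  then show "ideal_power n (points_ideal n X) d \<subseteq> ideal_power n (point_ideal n P) d"
    by (intro ideal_power_mono) (auto simp: points_ideal_def)
qed

lemma initial_terms_closed:
  assumes r: "monomial_ordering n r" "\<And>i. i < n \<Longrightarrow> (var_monom n, var_monom i) \<in> r"
  shows "initial_term r ` quadric_monomials n d \<subseteq> carrier (poly_ring n)"
proof -
  have "(\<Sum>i<n. Poly_Mapping.single i (2 * a i)) \<in> monomials n" for a
    using monic_leading_in_monomials[OF r(1) monic_leading_quadric_prod[OF r]] .
  then show ?thesis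
    by (auto simp: quadric_monomials_def initial_term_quadric_prod[OF r])
qed

text \<open>The initial monomial of an element of the ideal of the fat points is the index of a basis element
  with at least \<open>d\<close> factors \<open>Q\<^sub>i\<close>, and so it is divisible by the initial monomial of a product of
  \<open>d\<close> quadrics.\<close>

lemma initial_term_in_Idl:
  assumes r: "monomial_ordering n r" "\<And>i. i < n \<Longrightarrow> (var_monom n, var_monom i) \<in> r"
    and f: "f \<in> fat_points_ideal n (sign_points n) d"
  shows "initial_term r f \<in> Idl\<^bsub>poly_ring n\<^esub> (initial_term r ` quadric_monomials n d)"
    (is "_ \<in> ?I")
proof -
  note closed = initial_terms_closed[where d = d, OF r]
  have I: "ideal ?I (poly_ring n)" by (rule ideal_Idl(1)[OF closed])
  show ?thesis
  proof (cases "f = 0")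
    case True
    then show ?thesis using I by (simp add: ideal_poly_ring_iff initial_term_def)
  next
    case False
    obtain g where g: "Poly_Mapping.keys g \<subseteq> monomials n" "f = quadric_comb n g"
        "\<forall>m\<in>Poly_Mapping.keys g. d \<le> quadric_degree n m"
      using f by (rule fat_points_ideal_quadric_comb)
    define m where "m = initial_monom r f"
    have m: "m \<in> Poly_Mapping.keys g"
      using initial_monom_quadric_comb[OF r g(1)] False by (simp add: m_def g(2))
    obtain b where b: "\<And>i. b i \<le> Poly_Mapping.lookup m i div 2" "(\<Sum>i<n. b i) = d"
      using exists_le_sum_eq g(3)[rule_format, OF m] unfolding quadric_degree_def by blast
    define e where "e = (\<Sum>i<n. Poly_Mapping.single i (2 * b i))"
    have lookup_e: "Poly_Mapping.lookup e i = (if i < n then 2 * b i else 0)" for i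
      by (simp add: e_def lookup_sum lookup_single when_def)
    have "2 * b i \<le> Poly_Mapping.lookup m i" for i
      using b(1)[of i] by linarith
    then have "m - e + e = m"
      by (intro poly_mapping_eqI) (simp add: lookup_add lookup_minus lookup_e)
    then have init: "initial_term r f =
        Poly_Mapping.single (m - e) (Poly_Mapping.lookup f m) * Poly_Mapping.single e 1"
      using False by (simp add: initial_term_def mult_single flip: m_def)
    have "Poly_Mapping.single e 1 \<in> ?I"
    proof -
      have "(\<Prod>i<n. quadric n i ^ b i) \<in> quadric_monomials n d"
        using b(2) by (auto simp: quadric_monomials_def)
      then have "initial_term r (\<Prod>i<n. quadric n i ^ b i) \<in> ?I"
        using ideal_Idl(2)[OF closed] by blast
      then show ?thesis by (simp add: initial_term_quadric_prod[OF r] e_def)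
    qed
    moreover have "m - e \<in> monomials n"
      using m g(1) by (auto simp: monomials_def in_keys_iff lookup_minus subset_iff)
    then have "Poly_Mapping.keys (Poly_Mapping.single (m - e) (Poly_Mapping.lookup f m)) \<subseteq> monomials n"
      by simp
    ultimately show ?thesis
      unfolding init by (intro ideal_mult_closed[OF I])
  qed
qed

theorem corollary4p8:
  fixes n d :: nat
  assumes "n > 0" and "d > 0"
  shows "fat_points_ideal n (sign_points n) d = ideal_power n (points_ideal n (sign_points n)) d
    \<and> (\<forall>r. monomial_ordering n r \<and> (\<forall>i<n. (var_monom n, var_monom i) \<in> r) \<longrightarrow>
          is_groebner_basis n r (fat_points_ideal n (sign_points n) d) (quadric_monomials n d))"
proof (intro conjI allI impI)
  let ?F = "fat_points_ideal n (sign_points n) d" and ?G = "quadric_monomials n d"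
  note chain = fat_points_ideal_subset_Idl[of n d] Idl_subset_ideal_power[of n d]
    ideal_power_points_ideal_subset[of n "sign_points n" d]
  show "?F = ideal_power n (points_ideal n (sign_points n)) d"
    using chain by blast
  have Idl: "Idl\<^bsub>poly_ring n\<^esub> ?G = ?F"
    using chain by blast
  then have "?G \<subseteq> ?F"
    using ideal_Idl(2)[OF quadric_monomials_closed] by blast
  fix r assume "monomial_ordering n r \<and> (\<forall>i<n. (var_monom n, var_monom i) \<in> r)"
  then have r: "monomial_ordering n r" "\<And>i. i < n \<Longrightarrow> (var_monom n, var_monom i) \<in> r"
    by auto
  let ?inG = "Idl\<^bsub>poly_ring n\<^esub> (initial_term r ` ?G)" and ?inF = "Idl\<^bsub>poly_ring n\<^esub> (initial_term r ` ?F)"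
  have inF: "initial_term r ` ?F \<subseteq> ?inG"
    using initial_term_in_Idl[OF r] by blast
  have inG: "ideal ?inG (poly_ring n)"
    by (rule ideal_Idl(1)[OF initial_terms_closed[OF r]])
  have "initial_term r ` ?F \<subseteq> carrier (poly_ring n)"
    using inF inG unfolding ideal_poly_ring_iff by (meson order_trans)
  then have "?inG \<subseteq> ?inF"
    using \<open>?G \<subseteq> ?F\<close> ideal_Idl[of "initial_term r ` ?F" n] by (intro Idl_least) auto
  moreover have "?inF \<subseteq> ?inG"
    by (rule Idl_least[OF inG inF])
  ultimately show "is_groebner_basis n r ?F ?G"
    using Idl quadric_monomials_closed by (auto simp: is_groebner_basis_def initial_ideal_def)
qed

end
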